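(* Let $(X,\le)$ and $(Y,\le)$ be two (linearly) ordered sets, with order GT's $\mu$ and $\nu$. If $|X|=1<|Y|$, then there is no continuous map $f:(X,\mu)\to(Y,\nu)$. In all other cases, the continuous maps $f:(X,\mu)\to(Y,\nu)$ are exactly the (non-strictly) monotonically increasing or monotonically decreasing maps $X\to Y$ that are continuous between the respective order topologies of $(X,\le)$ and $(Y,\le)$.
   Context: A generalized topology (GT) on a set $X$ (possibly empty) is a family $\mu\subset P(X)$ with $\emptyset\in\mu$ closed under arbitrary unions. A map $f:(X,\mu)\to(Y,\nu)$ is continuous if $f^{-1}(N)\in\mu$ for all $N\in\nu$. For a linearly ordered set $(X,\le)$, the order GT on $X$ consists of all unions of (possibly empty) subfamilies of $$\{\{x\in X\mid x<a\}\mid a\in X\}\cup\{\{x\in X\mid x>b\}\mid b\in X\},$$ i.e. it has this family as a base. The order topology on $X$ is the usual topology having this same family as a subbase. *)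

theory Defs
  imports "HOL-Analysis.Analysis"
begin

text \<open>
  The ground set \<open>X\<close> is passed explicitly, since it may be empty and since it need not
  belong to \<open>\<mu>\<close>, so that it cannot be recovered as \<open>\<Union>\<mu>\<close>.
\<close>

definition generalized_topology_on :: "'a set \<Rightarrow> 'a set set \<Rightarrow> bool" where
  "generalized_topology_on X \<mu> \<longleftrightarrow>
     \<mu> \<subseteq> Pow X \<and> {} \<in> \<mu> \<and> (\<forall>\<F>. \<F> \<subseteq> \<mu> \<longrightarrow> \<Union>\<F> \<in> \<mu>)"

text \<open>As for \<open>continuous_map\<close>, values of \<open>f\<close> outside \<open>X\<close> are irrelevant.\<close>

definition gt_continuous_map ::
  "'a set \<Rightarrow> 'a set set \<Rightarrow> 'b set \<Rightarrow> 'b set set \<Rightarrow> ('a \<Rightarrow> 'b) \<Rightarrow> bool" where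
  "gt_continuous_map X \<mu> Y \<nu> f \<longleftrightarrow>
     f \<in> X \<rightarrow> Y \<and> (\<forall>N\<in>\<nu>. {x \<in> X. f x \<in> N} \<in> \<mu>)"

text \<open>Here \<open>r\<close> is the non-strict order, \<open>(x, y) \<in> r\<close> meaning \<open>x \<le> y\<close>.\<close>

definition open_rays :: "'a set \<Rightarrow> 'a rel \<Rightarrow> 'a set set" where
  "open_rays X r =
     {{x \<in> X. (x, a) \<in> r \<and> x \<noteq> a} | a. a \<in> X} \<union>
     {{x \<in> X. (b, x) \<in> r \<and> x \<noteq> b} | b. b \<in> X}"

definition order_gt :: "'a set \<Rightarrow> 'a rel \<Rightarrow> 'a set set" where
  "order_gt X r = {\<Union>\<F> | \<F>. \<F> \<subseteq> open_rays X r}"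

text \<open>
  The empty intersection of subbasic sets is taken to be \<open>X\<close>; hence \<open>X\<close> is open in the order
  topology even when \<open>X\<close> has one element, unlike in the order generalized topology. (The library's
  \<open>topology_generated_by\<close> would have the empty set as its space in that case.)
\<close>

definition order_topology_on :: "'a set \<Rightarrow> 'a rel \<Rightarrow> 'a topology" where
  "order_topology_on X r =
     topology (arbitrary union_of
       (finite intersection_of (\<lambda>S. S \<in> open_rays X r) relative_to X))"

lemma generalized_topology_on_order_gt: "generalized_topology_on X (order_gt X r)"
  unfolding generalized_topology_on_def
proof (intro conjI allI impI)
  show "order_gt X r \<subseteq> Pow X"
    by (auto simp: order_gt_def open_rays_def)
  show "{} \<in> order_gt X r"
    by (auto simp: order_gt_def)
  fix \<F> assume \<F>: "\<F> \<subseteq> order_gt X r"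
  have "\<Union>\<F> = \<Union>{R \<in> open_rays X r. R \<subseteq> \<Union>\<F>}"
  proof
    show "\<Union>\<F> \<subseteq> \<Union>{R \<in> open_rays X r. R \<subseteq> \<Union>\<F>}"
    proof
      fix x assume "x \<in> \<Union>\<F>"
      then obtain S where S: "S \<in> \<F>" "x \<in> S" by blast
      with \<F> obtain \<G> where "\<G> \<subseteq> open_rays X r" "S = \<Union>\<G>"
        unfolding order_gt_def by blast
      with S show "x \<in> \<Union>{R \<in> open_rays X r. R \<subseteq> \<Union>\<F>}" by blast
    qed
  qed blast
  then show "\<Union>\<F> \<in> order_gt X r"
    unfolding order_gt_def by blast
qed

lemma topspace_order_topology_on [simp]: "topspace (order_topology_on X r) = X"
  by (simp add: order_topology_on_def)

end

theory Submission
  imports Defs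
begin

text \<open>
  A member of the order GT contains, with each of its points, a whole open ray through that point.
  Rays are one-sided, so such a set cannot contain a point \<open>y\<close> while missing both a
  point below \<open>y\<close> and a point above \<open>y\<close>. Pulling back rays of
  \<open>Y\<close>, this says that \<open>f y\<close> is never strictly below, nor strictly above,
  both \<open>f x\<close> and \<open>f z\<close> when \<open>x \<le> y \<le> z\<close> (lemma
  \<open>gt_continuous_no_strict_dip\<close>, used for the order of \<open>Y\<close> and for its
  converse). A map that preserves betweenness in this way is monotone in one of the two directions
  (\<open>betweenness_imp_monotone\<close>). Since rays are open in the order topology,
  \<open>f\<close> is moreover continuous for the order topologies.

  Conversely, if \<open>f\<close> is monotone, the preimage of a ray is an initial or a final segment of \<open>X\<close>;
  continuity makes it open in the order topology. What remains is that such a segment is a union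
  of rays (\<open>open_initial_segment_in_order_gt\<close>). A proper open initial segment contains with each
  point \<open>x\<close> an interval \<open>[x, a)\<close>, hence the whole ray below \<open>a\<close>. The segment may also be all of
  \<open>X\<close>, and \<open>X\<close> is a union of rays unless it has exactly one point. This is the source of the
  exception in the theorem: when \<open>X\<close> is a point the only GT-open set is empty, whereas a \<open>Y\<close> with
  at least two points is covered by its rays.
\<close>

section \<open>Rays and the order GT\<close>

lemma linear_order_onD:
  assumes "linear_order_on X r"
  shows "r \<subseteq> X \<times> X"
    and "\<And>x. x \<in> X \<Longrightarrow> (x, x) \<in> r"
    and "\<And>x y z. (x, y) \<in> r \<Longrightarrow> (y, z) \<in> r \<Longrightarrow> (x, z) \<in> r"
    and "\<And>x y. (x, y) \<in> r \<Longrightarrow> (y, x) \<in> r \<Longrightarrow> x = y"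
    and "\<And>x y. x \<in> X \<Longrightarrow> y \<in> X \<Longrightarrow> (x, y) \<in> r \<or> (y, x) \<in> r"
proof -
  from assms have *: "r \<subseteq> X \<times> X" "refl_on X r" "trans r" "antisym r" "total_on X r"
    by (auto simp: order_on_defs)
  then show "r \<subseteq> X \<times> X"
    and refl: "\<And>x. x \<in> X \<Longrightarrow> (x, x) \<in> r"
    and "\<And>x y z. (x, y) \<in> r \<Longrightarrow> (y, z) \<in> r \<Longrightarrow> (x, z) \<in> r"
    and "\<And>x y. (x, y) \<in> r \<Longrightarrow> (y, x) \<in> r \<Longrightarrow> x = y"
    by (simp, simp add: refl_on_def, blast dest: transD, blast dest: antisymD)
  fix x y assume "x \<in> X" "y \<in> X"
  with *(5) refl show "(x, y) \<in> r \<or> (y, x) \<in> r"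
    by (cases "x = y") (auto simp: total_on_def)
qed

lemma open_raysE:
  assumes "R \<in> open_rays X r"
  obtains (below) a where "a \<in> X" "R = {x \<in> X. (x, a) \<in> r \<and> x \<noteq> a}"
  | (above) b where "b \<in> X" "R = {x \<in> X. (b, x) \<in> r \<and> x \<noteq> b}"
  using assms unfolding open_rays_def by blast

lemma open_rays_intros:
  assumes "a \<in> X"
  shows "{x \<in> X. (x, a) \<in> r \<and> x \<noteq> a} \<in> open_rays X r"
    and "{x \<in> X. (a, x) \<in> r \<and> x \<noteq> a} \<in> open_rays X r"
  using assms unfolding open_rays_def by blast+

text \<open>
  Reversing the order only exchanges the two kinds of rays. Every statement below about initial
  segments or about increasing maps thus has a mirror image that needs no separate proof.
\<close>

lemma open_rays_converse: "open_rays X (r\<inverse>) = open_rays X r"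
  unfolding open_rays_def by auto

lemma order_gt_converse: "order_gt X (r\<inverse>) = order_gt X r"
  by (simp add: order_gt_def open_rays_converse)

lemma order_topology_on_converse: "order_topology_on X (r\<inverse>) = order_topology_on X r"
  by (simp add: order_topology_on_def open_rays_converse)

lemma in_order_gt_iff:
  "S \<in> order_gt X r \<longleftrightarrow> (\<forall>x\<in>S. \<exists>R\<in>open_rays X r. x \<in> R \<and> R \<subseteq> S)"
proof
  assume "S \<in> order_gt X r"
  then show "\<forall>x\<in>S. \<exists>R\<in>open_rays X r. x \<in> R \<and> R \<subseteq> S"
    unfolding order_gt_def by blast
next
  assume "\<forall>x\<in>S. \<exists>R\<in>open_rays X r. x \<in> R \<and> R \<subseteq> S"
  then have "S = \<Union>{R \<in> open_rays X r. R \<subseteq> S}" by blast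
  then show "S \<in> order_gt X r"
    unfolding order_gt_def by blast
qed

lemma gt_continuous_map_order_gt_iff:
  "gt_continuous_map X (order_gt X r) Y (order_gt Y s) f \<longleftrightarrow>
     f \<in> X \<rightarrow> Y \<and> (\<forall>R\<in>open_rays Y s. {x \<in> X. f x \<in> R} \<in> order_gt X r)"
proof
  have "open_rays Y s \<subseteq> order_gt Y s"
    by (auto simp: in_order_gt_iff)
  then show "gt_continuous_map X (order_gt X r) Y (order_gt Y s) f \<Longrightarrow>
      f \<in> X \<rightarrow> Y \<and> (\<forall>R\<in>open_rays Y s. {x \<in> X. f x \<in> R} \<in> order_gt X r)"
    unfolding gt_continuous_map_def by blast
next
  assume f: "f \<in> X \<rightarrow> Y \<and> (\<forall>R\<in>open_rays Y s. {x \<in> X. f x \<in> R} \<in> order_gt X r)"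
  have "{x \<in> X. f x \<in> N} \<in> order_gt X r" if N: "N \<in> order_gt Y s" for N
    unfolding in_order_gt_iff
  proof
    fix x assume x: "x \<in> {x \<in> X. f x \<in> N}"
    with N obtain R where R: "R \<in> open_rays Y s" "f x \<in> R" "R \<subseteq> N"
      unfolding in_order_gt_iff by blast
    with f x have "\<exists>Q\<in>open_rays X r. x \<in> Q \<and> Q \<subseteq> {x \<in> X. f x \<in> R}"
      unfolding in_order_gt_iff by blast
    with R show "\<exists>Q\<in>open_rays X r. x \<in> Q \<and> Q \<subseteq> {x \<in> X. f x \<in> N}" by blast
  qed
  with f show "gt_continuous_map X (order_gt X r) Y (order_gt Y s) f"
    unfolding gt_continuous_map_def by blast
qed

lemma ray_through_point:
  assumes "linear_order_on X r" "x \<in> X" "y \<in> X" "x \<noteq> y"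
  obtains R where "R \<in> open_rays X r" "x \<in> R"
proof (cases "(x, y) \<in> r")
  case True
  with assms show ?thesis
    by (intro that[OF open_rays_intros(1)[of y]]) auto
next
  case False
  with assms linear_order_onD(5)[of X r x y] show ?thesis
    by (intro that[OF open_rays_intros(2)[of y]]) auto
qed

lemma open_rays_of_singleton: "R \<in> open_rays {p} r \<Longrightarrow> R = {}"
  by (auto elim!: open_raysE)

section \<open>GT-continuous maps are monotone\<close>

text \<open>
  If \<open>f y\<close> were strictly below both \<open>f x\<close> and \<open>f z\<close>, the
  ray below the smaller of these two would contain \<open>f y\<close> but neither of them; a ray
  through \<open>y\<close> inside its preimage would have to avoid \<open>x\<close> and
  \<open>z\<close>, that is, extend neither downwards nor upwards.
\<close>

lemma gt_continuous_no_strict_dip: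
  assumes r: "linear_order_on X r" and s: "linear_order_on Y s"
    and f: "gt_continuous_map X (order_gt X r) Y (order_gt Y s) f"
    and xy: "(x, y) \<in> r" and yz: "(y, z) \<in> r"
  shows "(f x, f y) \<in> s \<or> (f z, f y) \<in> s"
proof (rule ccontr)
  assume dip: "\<not> ((f x, f y) \<in> s \<or> (f z, f y) \<in> s)"
  note R = linear_order_onD[OF r] and S = linear_order_onD[OF s]
  have X: "x \<in> X" "y \<in> X" "z \<in> X"
    using R(1) xy yz by auto
  then have Y: "f x \<in> Y" "f y \<in> Y" "f z \<in> Y"
    using f unfolding gt_continuous_map_def by auto
  obtain b where b: "b \<in> {f x, f z}" "(b, f x) \<in> s" "(b, f z) \<in> s"
    using S(2)[OF Y(1)] S(2)[OF Y(3)] S(5)[OF Y(1,3)] by blast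
  then have bY: "b \<in> Y" and "(f y, b) \<in> s" "f y \<noteq> b"
    using Y dip S(5)[OF Y(2)] S(2)[OF Y(2)] by auto
  define P where "P = {u \<in> X. f u \<in> {v \<in> Y. (v, b) \<in> s \<and> v \<noteq> b}}"
  have "P \<in> order_gt X r"
    using f open_rays_intros(1)[OF bY] unfolding P_def gt_continuous_map_order_gt_iff by blast
  moreover have "y \<in> P"
    using X Y \<open>(f y, b) \<in> s\<close> \<open>f y \<noteq> b\<close> by (simp add: P_def)
  ultimately obtain Q where Q: "Q \<in> open_rays X r" "y \<in> Q" "Q \<subseteq> P"
    unfolding in_order_gt_iff by blast
  have "x \<notin> Q" "z \<notin> Q"
    using Q(3) b(2,3) S(4) by (auto simp: P_def)
  with Q(1,2) show False
  proof (cases rule: open_raysE)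
    case (below a)
    then have "(y, a) \<in> r" "y \<noteq> a" using Q(2) by auto
    then have "x \<in> Q" using below X(1) xy R(3)[of x y a] R(4)[of x y] by auto
    with \<open>x \<notin> Q\<close> show False ..
  next
    case (above c)
    then have "(c, y) \<in> r" "y \<noteq> c" using Q(2) by auto
    then have "z \<in> Q" using above X(3) yz R(3)[of c y z] R(4)[of y z] by auto
    with \<open>z \<notin> Q\<close> show False ..
  qed
qed

text \<open>
  If \<open>f\<close> preserves betweenness, its direction on an interval \<open>[m, M]\<close> is decided by its values at
  the two ends.
\<close>

lemma betweenness_imp_le_on_interval:
  assumes s: "linear_order_on Y s" and f: "f \<in> X \<rightarrow> Y" and r: "linear_order_on X r"
    and dip: "\<And>x y z. (x, y) \<in> r \<Longrightarrow> (y, z) \<in> r \<Longrightarrow> (f x, f y) \<in> s \<or> (f z, f y) \<in> s"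
    and peak: "\<And>x y z. (x, y) \<in> r \<Longrightarrow> (y, z) \<in> r \<Longrightarrow> (f y, f x) \<in> s \<or> (f y, f z) \<in> s"
    and le: "(m, x) \<in> r" "(x, y) \<in> r" "(y, M) \<in> r"
    and ends: "(f m, f M) \<in> s"
  shows "(f x, f y) \<in> s"
proof -
  note R = linear_order_onD[OF r] and S = linear_order_onD[OF s]
  have "(m, y) \<in> r" using R(3) le by blast
  then have "(f m, f y) \<in> s"
    using dip[of m y M] le S(3) ends by blast
  then show ?thesis
    using peak[of m x y] le S(3) by blast
qed

text \<open>
  Two pairs on which \<open>f\<close> moves in opposite directions lie in a common interval \<open>[m, M]\<close>, and the
  values at its ends exclude one of the two directions.
\<close>

lemma betweenness_imp_monotone:
  assumes r: "linear_order_on X r" and s: "linear_order_on Y s" and f: "f \<in> X \<rightarrow> Y"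
    and dip: "\<And>x y z. (x, y) \<in> r \<Longrightarrow> (y, z) \<in> r \<Longrightarrow> (f x, f y) \<in> s \<or> (f z, f y) \<in> s"
    and peak: "\<And>x y z. (x, y) \<in> r \<Longrightarrow> (y, z) \<in> r \<Longrightarrow> (f y, f x) \<in> s \<or> (f y, f z) \<in> s"
  shows "monotone_on X (\<lambda>x x'. (x, x') \<in> r) (\<lambda>y y'. (y, y') \<in> s) f \<or>
         monotone_on X (\<lambda>x x'. (x, x') \<in> r) (\<lambda>y y'. (y', y) \<in> s) f"
proof (rule ccontr)
  assume "\<not> ?thesis"
  then obtain a b c d where ab: "(a, b) \<in> r" "(f a, f b) \<notin> s"
      and cd: "(c, d) \<in> r" "(f d, f c) \<notin> s"
    unfolding monotone_on_def by blast
  note R = linear_order_onD[OF r] and S = linear_order_onD[OF s]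
  have X: "a \<in> X" "b \<in> X" "c \<in> X" "d \<in> X"
    using R(1) ab cd by auto
  obtain m where m: "m \<in> X" "(m, a) \<in> r" "(m, c) \<in> r"
    using R(2) R(5)[OF X(1,3)] X by blast
  obtain M where M: "M \<in> X" "(b, M) \<in> r" "(d, M) \<in> r"
    using R(2) R(5)[OF X(2,4)] X by blast
  have s': "linear_order_on Y (s\<inverse>)"
    using s by simp
  have "(f m, f M) \<in> s \<or> (f M, f m) \<in> s"
    using S(5) f m(1) M(1) by blast
  then show False
  proof
    assume "(f m, f M) \<in> s"
    with betweenness_imp_le_on_interval[OF s f r dip peak m(2) ab(1) M(2)] ab(2)
    show False by blast
  next
    assume "(f M, f m) \<in> s"
    then have "(f c, f d) \<in> s\<inverse>"
      by (intro betweenness_imp_le_on_interval[OF s' f r _ _ m(3) cd(1) M(3)])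
        (use dip peak in auto)
    with cd(2) show False by simp
  qed
qed

lemma gt_continuous_imp_monotone:
  assumes r: "linear_order_on X r" and s: "linear_order_on Y s"
    and f: "gt_continuous_map X (order_gt X r) Y (order_gt Y s) f"
  shows "monotone_on X (\<lambda>x x'. (x, x') \<in> r) (\<lambda>y y'. (y, y') \<in> s) f \<or>
         monotone_on X (\<lambda>x x'. (x, x') \<in> r) (\<lambda>y y'. (y', y) \<in> s) f"
proof (rule betweenness_imp_monotone[OF r s])
  show "f \<in> X \<rightarrow> Y"
    using f by (simp add: gt_continuous_map_def)
  fix x y z assume xyz: "(x, y) \<in> r" "(y, z) \<in> r"
  show "(f x, f y) \<in> s \<or> (f z, f y) \<in> s"
    by (rule gt_continuous_no_strict_dip[OF r s f xyz])
  have "(f x, f y) \<in> s\<inverse> \<or> (f z, f y) \<in> s\<inverse>"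
    by (rule gt_continuous_no_strict_dip[OF r _ _ xyz]) (use s f in \<open>simp_all add: order_gt_converse\<close>)
  then show "(f y, f x) \<in> s \<or> (f y, f z) \<in> s" by simp
qed

section \<open>The order topology\<close>

lemma continuous_map_order_topology_iff:
  "continuous_map T (order_topology_on Y s) f \<longleftrightarrow>
     f \<in> topspace T \<rightarrow> Y \<and> (\<forall>R\<in>open_rays Y s. openin T {x \<in> topspace T. f x \<in> R})"
  unfolding continuous_map_into_topology_subbase_eq[OF order_topology_on_def]
    topspace_order_topology_on Ball_def ..

lemma openin_order_topology_ray:
  assumes "R \<in> open_rays X r"
  shows "openin (order_topology_on X r) R"
proof -
  have "R \<subseteq> X"
    using assms by (auto elim: open_raysE)
  moreover have "openin (order_topology_on X r) {x \<in> X. id x \<in> R}"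
    using continuous_map_id[of "order_topology_on X r"] assms
    unfolding continuous_map_order_topology_iff by simp
  moreover have "{x \<in> X. id x \<in> R} = R"
    using \<open>R \<subseteq> X\<close> by auto
  ultimately show ?thesis by simp
qed

lemma openin_order_topology_if_order_gt:
  assumes "S \<in> order_gt X r"
  shows "openin (order_topology_on X r) S"
proof -
  obtain \<F> where "\<F> \<subseteq> open_rays X r" "S = \<Union>\<F>"
    using assms unfolding order_gt_def by blast
  then show ?thesis
    using openin_order_topology_ray by (metis openin_Union subsetD)
qed

text \<open>
  The sets containing with each point \<open>x\<close> an interval \<open>[x, a)\<close>, or everything from \<open>x\<close> on, form a
  topology (the lower limit topology). It contains the rays, hence is finer than the order
  topology, which gives the one-sided neighbourhoods without handling finite intersections of rays.
\<close>

definition right_open :: "'a set \<Rightarrow> 'a rel \<Rightarrow> 'a set \<Rightarrow> bool" where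
  "right_open X r U \<longleftrightarrow> U \<subseteq> X \<and>
     (\<forall>x\<in>U. (\<forall>w. (x, w) \<in> r \<longrightarrow> w \<in> U) \<or>
       (\<exists>a. (x, a) \<in> r \<and> x \<noteq> a \<and> (\<forall>w. (x, w) \<in> r \<and> (w, a) \<in> r \<and> w \<noteq> a \<longrightarrow> w \<in> U)))"

lemma right_open_Int:
  assumes r: "linear_order_on X r" and U: "right_open X r U" and V: "right_open X r V"
  shows "right_open X r (U \<inter> V)"
  unfolding right_open_def
proof (intro conjI ballI)
  note R = linear_order_onD[OF r]
  show "U \<inter> V \<subseteq> X" using U unfolding right_open_def by blast
  fix x assume x: "x \<in> U \<inter> V"
  let ?upto = "\<lambda>a W. (x, a) \<in> r \<and> x \<noteq> a \<and> (\<forall>w. (x, w) \<in> r \<and> (w, a) \<in> r \<and> w \<noteq> a \<longrightarrow> w \<in> W)"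
  let ?near = "\<lambda>W. (\<forall>w. (x, w) \<in> r \<longrightarrow> w \<in> W) \<or> (\<exists>a. ?upto a W)"
  have nU: "?near U" and nV: "?near V"
    using U V x unfolding right_open_def by auto
  show "?near (U \<inter> V)"
  proof (cases "(\<forall>w. (x, w) \<in> r \<longrightarrow> w \<in> U) \<or> (\<forall>w. (x, w) \<in> r \<longrightarrow> w \<in> V)")
    case True
    with nU nV show ?thesis by blast
  next
    case False
    with nU nV obtain a b where a: "?upto a U" and b: "?upto b V" by blast
    \<comment> \<open>the smaller of the two right ends serves both sets\<close>
    have "a \<in> X" "b \<in> X" using R(1) a b by auto
    then have "(a, b) \<in> r \<or> (b, a) \<in> r" by (rule R(5))
    then show ?thesis
    proof
      assume ab: "(a, b) \<in> r"
      have "w \<in> V" if "(x, w) \<in> r" "(w, a) \<in> r" "w \<noteq> a" for w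
        using b that R(3)[OF that(2) ab] R(4)[of w a] ab by auto
      with a have "?upto a (U \<inter> V)" by simp
      then show ?thesis by (intro disjI2 exI)
    next
      assume ba: "(b, a) \<in> r"
      have "w \<in> U" if "(x, w) \<in> r" "(w, b) \<in> r" "w \<noteq> b" for w
        using a that R(3)[OF that(2) ba] R(4)[of w b] ba by auto
      with b have "?upto b (U \<inter> V)" by simp
      then show ?thesis by (intro disjI2 exI)
    qed
  qed
qed

lemma right_open_Union:
  assumes "\<And>U. U \<in> \<U> \<Longrightarrow> right_open X r U"
  shows "right_open X r (\<Union>\<U>)"
  unfolding right_open_def
proof (intro conjI ballI)
  show "\<Union>\<U> \<subseteq> X" using assms unfolding right_open_def by blast
  fix x assume "x \<in> \<Union>\<U>"
  then obtain U where U: "U \<in> \<U>" "x \<in> U" by blast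
  then have "(\<forall>w. (x, w) \<in> r \<longrightarrow> w \<in> U) \<or>
      (\<exists>a. (x, a) \<in> r \<and> x \<noteq> a \<and> (\<forall>w. (x, w) \<in> r \<and> (w, a) \<in> r \<and> w \<noteq> a \<longrightarrow> w \<in> U))"
    using assms[OF U(1)] unfolding right_open_def by simp
  with U(1) show "(\<forall>w. (x, w) \<in> r \<longrightarrow> w \<in> \<Union>\<U>) \<or>
      (\<exists>a. (x, a) \<in> r \<and> x \<noteq> a \<and> (\<forall>w. (x, w) \<in> r \<and> (w, a) \<in> r \<and> w \<noteq> a \<longrightarrow> w \<in> \<Union>\<U>))"
    by blast
qed

lemma right_open_ray:
  assumes r: "linear_order_on X r" and "R \<in> open_rays X r"
  shows "right_open X r R"
  using assms(2)
proof (cases rule: open_raysE)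
  case (below a)
  then show ?thesis
    using linear_order_onD(1)[OF r] unfolding right_open_def by blast
next
  case (above b)
  then show ?thesis
    using linear_order_onD(1,3,4)[OF r] unfolding right_open_def by blast
qed

lemma openin_order_topology_imp_right_open:
  assumes r: "linear_order_on X r" and U: "openin (order_topology_on X r) U"
  shows "right_open X r U"
proof -
  have "istopology (right_open X r)"
    unfolding istopology_def by (blast intro: right_open_Int[OF r] right_open_Union)
  then have eq: "openin (topology (right_open X r)) = right_open X r"
    by (rule topology_inverse')
  have "right_open X r X"
    using linear_order_onD(1)[OF r] unfolding right_open_def by blast
  then have "openin (topology (right_open X r)) X"
    by (simp add: eq)
  with _ have "openin (topology (right_open X r)) U"
    by (rule minimal_topology_subbase[OF _ _ U[unfolded order_topology_on_def]])
      (simp add: eq right_open_ray[OF r])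
  then show ?thesis by (simp add: eq)
qed

section \<open>Monotone continuous maps are GT-continuous\<close>

text \<open>
  An initial segment containing \<open>[x, a)\<close> contains the ray below \<open>a\<close>; one containing everything from
  \<open>x\<close> on is all of \<open>X\<close>, which is a union of rays because it is not a single point.
\<close>

lemma open_initial_segment_in_order_gt:
  assumes r: "linear_order_on X r" and card: "card X \<noteq> 1"
    and D: "openin (order_topology_on X r) D"
    and down: "\<And>x w. x \<in> D \<Longrightarrow> (w, x) \<in> r \<Longrightarrow> w \<in> D"
  shows "D \<in> order_gt X r"
  unfolding in_order_gt_iff
proof
  note R = linear_order_onD[OF r]
  fix x assume x: "x \<in> D"
  have DX: "D \<subseteq> X"
    using D openin_subset by fastforce
  have "right_open X r D"
    by (rule openin_order_topology_imp_right_open[OF r D])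
  then consider (all) "\<forall>w. (x, w) \<in> r \<longrightarrow> w \<in> D"
    | (upto) a where "(x, a) \<in> r" "x \<noteq> a" "\<forall>w. (x, w) \<in> r \<and> (w, a) \<in> r \<and> w \<noteq> a \<longrightarrow> w \<in> D"
    using x unfolding right_open_def by blast
  then show "\<exists>Q\<in>open_rays X r. x \<in> Q \<and> Q \<subseteq> D"
  proof cases
    case all
    then have "X \<subseteq> D" using R(5) down x DX by blast
    have "X \<noteq> {x}" using card by auto
    then obtain y where "y \<in> X" "x \<noteq> y" using x DX by blast
    then obtain Q where "Q \<in> open_rays X r" "x \<in> Q"
      using ray_through_point[OF r] x DX by blast
    moreover from this have "Q \<subseteq> X"
      by (auto elim: open_raysE)
    ultimately show ?thesis using \<open>X \<subseteq> D\<close> by blast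
  next
    case (upto a)
    let ?Q = "{w \<in> X. (w, a) \<in> r \<and> w \<noteq> a}"
    have "a \<in> X" using R(1) upto(1) by blast
    moreover have "x \<in> ?Q" using x DX upto by blast
    moreover have "?Q \<subseteq> D" using upto(3) R(5) down x DX by blast
    ultimately show ?thesis by (intro bexI[OF _ open_rays_intros(1)[of a]] conjI)
  qed
qed

lemma increasing_continuous_imp_gt_continuous:
  assumes r: "linear_order_on X r" and s: "linear_order_on Y s" and card: "card X \<noteq> 1"
    and mono: "monotone_on X (\<lambda>x x'. (x, x') \<in> r) (\<lambda>y y'. (y, y') \<in> s) f"
    and cont: "continuous_map (order_topology_on X r) (order_topology_on Y s) f"
  shows "gt_continuous_map X (order_gt X r) Y (order_gt Y s) f"
  unfolding gt_continuous_map_order_gt_iff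
proof (intro conjI ballI)
  note R = linear_order_onD[OF r] and S = linear_order_onD[OF s]
  show f: "f \<in> X \<rightarrow> Y"
    using cont unfolding continuous_map_order_topology_iff by simp
  have le: "(f x, f x') \<in> s" if "(x, x') \<in> r" for x x'
    using mono that R(1) unfolding monotone_on_def by blast
  fix Q assume Q: "Q \<in> open_rays Y s"
  let ?P = "{x \<in> X. f x \<in> Q}"
  have P: "openin (order_topology_on X r) ?P"
    using cont Q unfolding continuous_map_order_topology_iff by simp
  from Q show "?P \<in> order_gt X r"
  proof (cases rule: open_raysE)
    case (below a)
    show ?thesis
    proof (rule open_initial_segment_in_order_gt[OF r card P])
      fix x w assume "x \<in> ?P" "(w, x) \<in> r"
      then show "w \<in> ?P"
        using below le[of w x] R(1) f S(3)[of "f w" "f x" a] S(4)[of "f x" a] by auto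
    qed
  next
    case (above b)
    have "?P \<in> order_gt X (r\<inverse>)"
    proof (rule open_initial_segment_in_order_gt[OF _ card])
      show "linear_order_on X (r\<inverse>)" using r by simp
      show "openin (order_topology_on X (r\<inverse>)) ?P"
        using P by (simp add: order_topology_on_converse)
      fix x w assume "x \<in> ?P" "(w, x) \<in> r\<inverse>"
      then show "w \<in> ?P"
        using above le[of x w] R(1) f S(3)[of b "f x" "f w"] S(4)[of "f x" b] by auto
    qed
    then show ?thesis by (simp add: order_gt_converse)
  qed
qed

lemma monotone_continuous_imp_gt_continuous:
  assumes r: "linear_order_on X r" and s: "linear_order_on Y s" and card: "card X \<noteq> 1"
    and mono: "monotone_on X (\<lambda>x x'. (x, x') \<in> r) (\<lambda>y y'. (y, y') \<in> s) f \<or>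
               monotone_on X (\<lambda>x x'. (x, x') \<in> r) (\<lambda>y y'. (y', y) \<in> s) f"
    and cont: "continuous_map (order_topology_on X r) (order_topology_on Y s) f"
  shows "gt_continuous_map X (order_gt X r) Y (order_gt Y s) f"
  using mono
proof
  assume "monotone_on X (\<lambda>x x'. (x, x') \<in> r) (\<lambda>y y'. (y, y') \<in> s) f"
  then show ?thesis
    by (rule increasing_continuous_imp_gt_continuous[OF r s card _ cont])
next
  assume "monotone_on X (\<lambda>x x'. (x, x') \<in> r) (\<lambda>y y'. (y', y) \<in> s) f"
  then have "gt_continuous_map X (order_gt X r) Y (order_gt Y (s\<inverse>)) f"
    using r s card cont
    by (intro increasing_continuous_imp_gt_continuous) (simp_all add: order_topology_on_converse)
  then show ?thesis by (simp add: order_gt_converse)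
qed

lemma gt_continuous_imp_continuous:
  assumes "gt_continuous_map X (order_gt X r) Y (order_gt Y s) f"
  shows "continuous_map (order_topology_on X r) (order_topology_on Y s) f"
  unfolding continuous_map_order_topology_iff topspace_order_topology_on
proof (intro conjI ballI)
  show "f \<in> X \<rightarrow> Y"
    using assms by (simp add: gt_continuous_map_def)
  fix R assume "R \<in> open_rays Y s"
  with assms have "{x \<in> X. f x \<in> R} \<in> order_gt X r"
    unfolding gt_continuous_map_order_gt_iff by blast
  then show "openin (order_topology_on X r) {x \<in> X. f x \<in> R}"
    by (rule openin_order_topology_if_order_gt)
qed

section \<open>One-point sets and the characterization\<close>

lemma gt_continuous_from_singleton_imp_eq:
  assumes s: "linear_order_on Y s"
    and f: "gt_continuous_map {p} (order_gt {p} r) Y (order_gt Y s) f"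
  shows "Y = {f p}"
proof (rule ccontr)
  assume "Y \<noteq> {f p}"
  have "f p \<in> Y" using f unfolding gt_continuous_map_def by auto
  with \<open>Y \<noteq> {f p}\<close> obtain y where "y \<in> Y" "f p \<noteq> y" by blast
  with \<open>f p \<in> Y\<close> obtain R where "R \<in> open_rays Y s" "f p \<in> R"
    using ray_through_point[OF s] by blast
  then have "{x \<in> {p}. f x \<in> R} \<in> order_gt {p} r"
    using f unfolding gt_continuous_map_order_gt_iff by blast
  then obtain Q where "Q \<in> open_rays {p} r" "p \<in> Q"
    using \<open>f p \<in> R\<close> unfolding in_order_gt_iff by auto
  then show False
    using open_rays_of_singleton[of Q p r] by simp
qed

lemma gt_continuous_into_singleton:
  assumes "f \<in> X \<rightarrow> {q}"
  shows "gt_continuous_map X (order_gt X r) {q} (order_gt {q} s) f"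
  unfolding gt_continuous_map_order_gt_iff
proof (intro conjI ballI)
  fix R assume "R \<in> open_rays {q} s"
  then have "R = {}" by (rule open_rays_of_singleton)
  then show "{x \<in> X. f x \<in> R} \<in> order_gt X r"
    by (simp add: in_order_gt_iff)
qed (use assms in simp)

theorem proposition4p15:
  fixes X :: "'a set" and r :: "'a rel" and Y :: "'b set" and s :: "'b rel"
  assumes "linear_order_on X r" and "linear_order_on Y s"
  shows "(card X = 1 \<and> (infinite Y \<or> 1 < card Y) \<longrightarrow>
            \<not> (\<exists>f. gt_continuous_map X (order_gt X r) Y (order_gt Y s) f)) \<and>
         (\<not> (card X = 1 \<and> (infinite Y \<or> 1 < card Y)) \<longrightarrow>
            (\<forall>f. gt_continuous_map X (order_gt X r) Y (order_gt Y s) f \<longleftrightarrow>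
               (monotone_on X (\<lambda>x x'. (x, x') \<in> r) (\<lambda>y y'. (y, y') \<in> s) f \<or>
                monotone_on X (\<lambda>x x'. (x, x') \<in> r) (\<lambda>y y'. (y', y) \<in> s) f) \<and>
               continuous_map (order_topology_on X r) (order_topology_on Y s) f))"
proof (intro conjI impI allI)
  assume card: "card X = 1 \<and> (infinite Y \<or> 1 < card Y)"
  then obtain p where "X = {p}" by (auto simp: card_1_singleton_iff)
  show "\<not> (\<exists>f. gt_continuous_map X (order_gt X r) Y (order_gt Y s) f)"
  proof
    assume "\<exists>f. gt_continuous_map X (order_gt X r) Y (order_gt Y s) f"
    then obtain f where "gt_continuous_map {p} (order_gt {p} r) Y (order_gt Y s) f"
      unfolding \<open>X = {p}\<close> ..
    then have "Y = {f p}"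
      by (rule gt_continuous_from_singleton_imp_eq[OF assms(2)])
    with card show False by simp
  qed
next
  fix f
  assume card: "\<not> (card X = 1 \<and> (infinite Y \<or> 1 < card Y))"
  show "gt_continuous_map X (order_gt X r) Y (order_gt Y s) f \<longleftrightarrow>
      (monotone_on X (\<lambda>x x'. (x, x') \<in> r) (\<lambda>y y'. (y, y') \<in> s) f \<or>
       monotone_on X (\<lambda>x x'. (x, x') \<in> r) (\<lambda>y y'. (y', y) \<in> s) f) \<and>
      continuous_map (order_topology_on X r) (order_topology_on Y s) f"
    (is "?gt \<longleftrightarrow> ?mono \<and> ?cont")
  proof
    assume ?gt
    then show "?mono \<and> ?cont"
      using gt_continuous_imp_monotone[OF assms] gt_continuous_imp_continuous by blast
  next
    assume R: "?mono \<and> ?cont"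
    show ?gt
    proof (cases "card X = 1")
      case False
      with R show ?thesis
        using monotone_continuous_imp_gt_continuous[OF assms] by blast
    next
      case True
      then obtain p where X: "X = {p}" by (auto simp: card_1_singleton_iff)
      have f: "f \<in> X \<rightarrow> Y"
        using R unfolding continuous_map_order_topology_iff by simp
      have "finite Y" "card Y \<le> 1" using card True by auto
      then have "Y = {f p}"
        using f X by (auto simp: card_le_Suc0_iff_eq)
      with f show ?thesis
        using gt_continuous_into_singleton[of f X "f p" r s] by simp
    qed
  qed
qed

end
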